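(* Let $k\ge1$ and let $V$ be any level $k$ integrable module of $U_q(\hat{\mathfrak{sl}}(n))$. Then, for all indices $i$ (and $i\pm1$) in $\{1,\dots,n-1\}$, the following hold on $V$: 1. the correlation functions of $x_i^+(z)x_i^+(w)$ have at most poles at $zq^{-2}=w$; 2. the correlation functions of $x_{i\pm1}^+(z)x_i^+(w)$ have at most poles at $zq=w$; 3. the correlation functions of $x_i^-(z)x_i^-(w)$ have at most poles at $zq^{2}=w$; 4. the correlation functions of $x_{i\pm1}^-(z)x_i^-(w)$ have at most poles at $zq^{-1}=w$.
   Context: Here $q$ is generic (a formal parameter; the base field is $\mathbb{C}(q)$ with $q^{1/2}$ adjoined), and $A=(a_{ij})$ denotes the Cartan matrix of type $A_{n-1}$. Drinfeld's current realization: $U_q(\hat{\mathfrak{sl}}(n))$ is the associative unital algebra with generators $\varphi_i(-m),\psi_i(m)$ ($m\in\mathbb{Z}_{\ge0}$), $x_i^{\pm}(l)$ ($l\in\mathbb{Z}$), $i=1,\dots,n-1$, and a central element $c$ (entering through $q^{\pm c/2}$), with $\varphi_i(0),\psi_i(0)$ invertible and mutually inverse. Put $x_i^{\pm}(z)=\sum_{l\in\mathbb{Z}}x_i^{\pm}(l)z^{-l}$, $\varphi_i(z)=\sum_{m\in-\mathbb{Z}_{\ge0}}\varphi_i(m)z^{-m}$, $\psi_i(z)=\sum_{m\in\mathbb{Z}_{\ge0}}\psi_i(m)z^{-m}$. The defining relations are - $\varphi_i(z)\varphi_j(w)=\varphi_j(w)\varphi_i(z)$, $\psi_i(z)\psi_j(w)=\psi_j(w)\psi_i(z)$,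 - $\varphi_i(z)\psi_j(w)\varphi_i(z)^{-1}\psi_j(w)^{-1}=\dfrac{g_{ij}(\frac zw q^{-c})}{g_{ij}(\frac zw q^{c})}$, - $\varphi_i(z)x_j^{\pm}(w)\varphi_i(z)^{-1}=g_{ij}(\frac zw q^{\mp c/2})^{\pm1}x_j^{\pm}(w)$, - $\psi_i(z)x_j^{\pm}(w)\psi_i(z)^{-1}=g_{ij}(\frac wz q^{\mp c/2})^{\mp1}x_j^{\pm}(w)$, - $[x_i^+(z),x_j^-(w)]=\frac{\delta_{i,j}}{q-q^{-1}}\{\delta(\frac zw q^{-c})\psi_i(wq^{c/2})-\delta(\frac zw q^{c})\varphi_i(zq^{c/2})\}$, - $(z-q^{\pm a_{ij}}w)x_i^{\pm}(z)x_j^{\pm}(w)=(q^{\pm a_{ij}}z-w)x_j^{\pm}(w)x_i^{\pm}(z)$, - $[x_i^{\pm}(z),x_j^{\pm}(w)]=0$ if $a_{ij}=0$, - $x_i^{\pm}(z_1)x_i^{\pm}(z_2)x_j^{\pm}(w)-(q+q^{-1})x_i^{\pm}(z_1)x_j^{\pm}(w)x_i^{\pm}(z_2)+x_j^{\pm}(w)x_i^{\pm}(z_1)x_i^{\pm}(z_2)+\{z_1\leftrightarrow z_2\}=0$ if $a_{ij}=-1$, where $\delta(z)=\sum_{j\in\mathbb{Z}}z^j$ and $g_{ij}(z)=\frac{q^{a_{ij}}z-1}{z-q^{a_{ij}}}$ is expanded about $z=0$. A level $k$ integrable module means an integrable highest weight module (with respect to the standard identification of this algebra with the Drinfeld–Jimbo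 algebra $U_q(\hat{\mathfrak{sl}}(n))$: highest weight dominant integral, Chevalley generators acting locally nilpotently) on which $c$ acts as the scalar $k$. The correlation functions of a product of two currents $X(z)Y(w)$ on $V$ are its matrix coefficients $\langle v^*, X(z)Y(w)v\rangle$, for $v\in V$ and $v^*$ in the restricted (weight-graded) dual of $V$. Each is a formal Laurent series understood as the expansion, in the region $|z|\gg|w|$, of a rational function; "has at most poles at $L$" means this rational function has no poles at nonzero $z,w$ other than possibly along the locus $L$. *)

theory Defs
  imports
    "HOL-Computational_Algebra.Computational_Algebra"
    "HOL-Algebra.Algebraic_Closure_Type"
begin

text \<open>Adjoining a square root of \<open>q\<close> to the field of rational functions in \<open>q\<close> gives the
  field of rational functions in \<open>qhalf\<close>, the square root of \<open>q\<close>.\<close>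

type_synonym base = "complex poly fract"

definition qhalf :: base where
  "qhalf = Fract [:0, 1:] 1"

definition q :: base where
  "q = qhalf ^ 2"

datatype pm = Pos | Neg

fun sgn_pm :: "pm \<Rightarrow> int" where
  "sgn_pm Pos = 1"
| "sgn_pm Neg = - 1"

fun opp :: "pm \<Rightarrow> pm" where
  "opp Pos = Neg"
| "opp Neg = Pos"

definition cartan :: "nat \<Rightarrow> nat \<Rightarrow> int" where
  "cartan i j = (if i = j then 2 else if i = Suc j \<or> j = Suc i then - 1 else 0)"

definition g :: "nat \<Rightarrow> nat \<Rightarrow> base fps" where
  "g i j = (fps_const (q powi cartan i j) * fps_X - 1)
             * inverse (fps_X - fps_const (q powi cartan i j))"

fun g_pm :: "pm \<Rightarrow> nat \<Rightarrow> nat \<Rightarrow> base fps" where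
  "g_pm Pos i j = g i j"
| "g_pm Neg i j = inverse (g i j)"

text \<open>A module is given by the operators through which the generators act: \<open>phi M i m\<close> is
  the mode \<open>- m\<close> of the series \<open>\<phi>\<close> of index \<open>i\<close> and \<open>psi M i m\<close> is the mode \<open>m\<close> of \<open>\<psi>\<close>, for
  a natural number \<open>m\<close>; \<open>cur M Pos i l\<close> and \<open>cur M Neg i l\<close> are the modes \<open>l\<close> of the currents
  \<open>x\<^sup>+\<close> and \<open>x\<^sup>-\<close>; and \<open>qc M j\<close> is the action of \<open>q\<close> to the power \<open>j c / 2\<close>, where \<open>c\<close> is the
  central element.\<close>

record 'v currents =
  phi :: "nat \<Rightarrow> nat \<Rightarrow> 'v \<Rightarrow> 'v"
  psi :: "nat \<Rightarrow> nat \<Rightarrow> 'v \<Rightarrow> 'v"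
  cur :: "pm \<Rightarrow> nat \<Rightarrow> int \<Rightarrow> 'v \<Rightarrow> 'v"
  qc :: "int \<Rightarrow> 'v \<Rightarrow> 'v"

text \<open>The modes indexed as in the generating series, where the coefficients of the half
  of the powers not occurring in the series vanish.\<close>

definition phi_mode :: "('v::zero) currents \<Rightarrow> nat \<Rightarrow> int \<Rightarrow> 'v \<Rightarrow> 'v" where
  "phi_mode M i m v = (if m \<le> 0 then phi M i (nat (- m)) v else 0)"

definition psi_mode :: "('v::zero) currents \<Rightarrow> nat \<Rightarrow> int \<Rightarrow> 'v \<Rightarrow> 'v" where
  "psi_mode M i m v = (if m \<ge> 0 then psi M i (nat m) v else 0)"

text \<open>The coefficient of \<open>z1\<close> to the \<open>- m1\<close>, \<open>z2\<close> to the \<open>- m2\<close>, \<open>w\<close> to the \<open>- l\<close> in the Serre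
  relation, before symmetrization.\<close>

definition serre ::
  "(base \<Rightarrow> 'v \<Rightarrow> 'v::ab_group_add) \<Rightarrow> 'v currents \<Rightarrow> pm \<Rightarrow> nat \<Rightarrow> nat
     \<Rightarrow> int \<Rightarrow> int \<Rightarrow> int \<Rightarrow> 'v \<Rightarrow> 'v" where
  "serre scale M e i j m1 m2 l v =
     cur M e i m1 (cur M e i m2 (cur M e j l v))
     - scale (q + inverse q) (cur M e i m1 (cur M e j l (cur M e i m2 v)))
     + cur M e j l (cur M e i m1 (cur M e i m2 v))"

text \<open>The relations are the identities between the coefficients of the generating series.
  In the relations involving \<open>g\<close>, the inverse series on the left-hand side have been moved
  to the right; \<open>r\<close> is the power of \<open>z / w\<close> (respectively \<open>w / z\<close>) taken from the expansion
  of the structure function.  In \<open>phi_psi\<close>, the ratio of the two values of \<open>g\<close> is expanded as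
  the product of \<open>g\<close> and of its inverse series.\<close>

locale drinfeld_module = vector_space scale
  for scale :: "base \<Rightarrow> 'v \<Rightarrow> 'v::ab_group_add" +
  fixes n :: nat and M :: "'v currents"
  assumes phi_linear: "i \<in> {1..<n} \<Longrightarrow> Vector_Spaces.linear scale scale (phi M i m)"
    and psi_linear: "i \<in> {1..<n} \<Longrightarrow> Vector_Spaces.linear scale scale (psi M i m)"
    and cur_linear: "i \<in> {1..<n} \<Longrightarrow> Vector_Spaces.linear scale scale (cur M e i l)"
    and qc_linear: "Vector_Spaces.linear scale scale (qc M j)"
    and qc_0: "qc M 0 v = v"
    and qc_add: "qc M (j + j') v = qc M j (qc M j' v)"
    and qc_phi: "i \<in> {1..<n} \<Longrightarrow> qc M j (phi M i m v) = phi M i m (qc M j v)"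
    and qc_psi: "i \<in> {1..<n} \<Longrightarrow> qc M j (psi M i m v) = psi M i m (qc M j v)"
    and qc_cur: "i \<in> {1..<n} \<Longrightarrow> qc M j (cur M e i l v) = cur M e i l (qc M j v)"
    and phi_0_psi_0: "i \<in> {1..<n} \<Longrightarrow> phi M i 0 (psi M i 0 v) = v"
    and psi_0_phi_0: "i \<in> {1..<n} \<Longrightarrow> psi M i 0 (phi M i 0 v) = v"
    and phi_phi: "i \<in> {1..<n} \<Longrightarrow> j \<in> {1..<n} \<Longrightarrow>
      phi M i m (phi M j l v) = phi M j l (phi M i m v)"
    and psi_psi: "i \<in> {1..<n} \<Longrightarrow> j \<in> {1..<n} \<Longrightarrow>
      psi M i m (psi M j l v) = psi M j l (psi M i m v)"
    and phi_psi: "i \<in> {1..<n} \<Longrightarrow> j \<in> {1..<n} \<Longrightarrow>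
      phi M i m (psi M j l' v) =
        (\<Sum>r\<le>min m l'. \<Sum>a\<le>r.
           scale (fps_nth (g i j) a * fps_nth (inverse (g i j)) (r - a))
             (qc M (2 * int (r - a) - 2 * int a)
               (psi M j (l' - r) (phi M i (m - r) v))))"
    and phi_cur: "i \<in> {1..<n} \<Longrightarrow> j \<in> {1..<n} \<Longrightarrow>
      phi M i m (cur M e j l v) =
        (\<Sum>r\<le>m. scale (fps_nth (g_pm e i j) r)
           (qc M (- sgn_pm e * int r) (cur M e j (l - int r) (phi M i (m - r) v))))"
    and psi_cur: "i \<in> {1..<n} \<Longrightarrow> j \<in> {1..<n} \<Longrightarrow>
      psi M i m (cur M e j l v) =
        (\<Sum>r\<le>m. scale (fps_nth (g_pm (opp e) i j) r)
           (qc M (- sgn_pm e * int r) (cur M e j (l + int r) (psi M i (m - r) v))))"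
    and cur_Pos_Neg: "i \<in> {1..<n} \<Longrightarrow> j \<in> {1..<n} \<Longrightarrow>
      cur M Pos i k (cur M Neg j l v) - cur M Neg j l (cur M Pos i k v) =
        (if i = j then scale (1 / (q - inverse q))
           (qc M (k - l) (psi_mode M i (k + l) v) - qc M (l - k) (phi_mode M i (k + l) v))
         else 0)"
    and cur_cur: "i \<in> {1..<n} \<Longrightarrow> j \<in> {1..<n} \<Longrightarrow>
      cur M e i (k + 1) (cur M e j l v)
        - scale (q powi (sgn_pm e * cartan i j)) (cur M e i k (cur M e j (l + 1) v)) =
      scale (q powi (sgn_pm e * cartan i j)) (cur M e j l (cur M e i (k + 1) v))
        - cur M e j (l + 1) (cur M e i k v)"
    and cur_commute: "i \<in> {1..<n} \<Longrightarrow> j \<in> {1..<n} \<Longrightarrow> cartan i j = 0 \<Longrightarrow>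
      cur M e i k (cur M e j l v) = cur M e j l (cur M e i k v)"
    and cur_serre: "i \<in> {1..<n} \<Longrightarrow> j \<in> {1..<n} \<Longrightarrow> cartan i j = - 1 \<Longrightarrow>
      serre scale M e i j m1 m2 l v + serre scale M e i j m2 m1 l v = 0"

text \<open>The iterated \<open>q\<close>-commutator \<open>[x(n-1)(0), [\<dots>, [x2(0), x1(l)] \<dots>]]\<close>, where \<open>[a, b]\<close> stands
  for \<open>a b - (1/q) b a\<close>.\<close>

definition theta_cur ::
  "(base \<Rightarrow> 'v \<Rightarrow> 'v::ab_group_add) \<Rightarrow> nat \<Rightarrow> 'v currents \<Rightarrow> pm \<Rightarrow> int \<Rightarrow> 'v \<Rightarrow> 'v" where
  "theta_cur scale n M e l =
     fold (\<lambda>j T v. cur M e j 0 (T v) - scale (inverse q) (T (cur M e j 0 v)))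
       [2..<n] (cur M e 1 l)"

text \<open>The Chevalley generators of index \<open>0, \<dots>, n - 1\<close> under the identification with the
  Drinfeld-Jimbo algebra: \<open>psi M i 0\<close> is the Cartan generator of index \<open>i > 0\<close>, and the one of
  index \<open>0\<close> is \<open>q\<close> to the \<open>c\<close> divided by the product of the others.  The scalar in \<open>chev_f\<close>
  normalizes the commutator of \<open>chev_e 0\<close> and \<open>chev_f 0\<close>.\<close>

definition chev_t :: "nat \<Rightarrow> 'v currents \<Rightarrow> nat \<Rightarrow> 'v \<Rightarrow> 'v" where
  "chev_t n M i =
     (if i = 0 then qc M 2 \<circ> foldr (\<lambda>j T. phi M j 0 \<circ> T) [1..<n] id else psi M i 0)"

definition chev_t_inv :: "nat \<Rightarrow> 'v currents \<Rightarrow> nat \<Rightarrow> 'v \<Rightarrow> 'v" where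
  "chev_t_inv n M i =
     (if i = 0 then qc M (- 2) \<circ> foldr (\<lambda>j T. psi M j 0 \<circ> T) [1..<n] id else phi M i 0)"

definition chev_e ::
  "(base \<Rightarrow> 'v \<Rightarrow> 'v::ab_group_add) \<Rightarrow> nat \<Rightarrow> 'v currents \<Rightarrow> nat \<Rightarrow> 'v \<Rightarrow> 'v" where
  "chev_e scale n M i =
     (if i = 0 then theta_cur scale n M Neg 1 \<circ> chev_t n M 0 else cur M Pos i 0)"

definition chev_f ::
  "(base \<Rightarrow> 'v \<Rightarrow> 'v::ab_group_add) \<Rightarrow> nat \<Rightarrow> 'v currents \<Rightarrow> nat \<Rightarrow> 'v \<Rightarrow> 'v" where
  "chev_f scale n M i =
     (if i = 0
      then scale ((- q) ^ (n - 2)) \<circ> (chev_t_inv n M 0 \<circ> theta_cur scale n M Pos (- 1))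
      else cur M Neg i 0)"

definition submodule ::
  "(base \<Rightarrow> 'v \<Rightarrow> 'v::ab_group_add) \<Rightarrow> nat \<Rightarrow> 'v currents \<Rightarrow> 'v set \<Rightarrow> bool" where
  "submodule scale n M S \<longleftrightarrow> module.subspace scale S \<and>
     (\<forall>i\<in>{1..<n}. \<forall>v\<in>S. (\<forall>m. phi M i m v \<in> S \<and> psi M i m v \<in> S) \<and> (\<forall>e l. cur M e i l v \<in> S)) \<and>
     (\<forall>j. \<forall>v\<in>S. qc M j v \<in> S)"

locale integrable_highest_weight_module = drinfeld_module scale n M
  for scale :: "base \<Rightarrow> 'v \<Rightarrow> 'v::ab_group_add" and n and M +
  fixes hw :: "nat \<Rightarrow> nat" and vhw :: 'v
  assumes vhw_nonzero: "vhw \<noteq> 0"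
    and e_vhw: "i < n \<Longrightarrow> chev_e scale n M i vhw = 0"
    and t_vhw: "i < n \<Longrightarrow> chev_t n M i vhw = scale (q ^ hw i) vhw"
    and cyclic: "submodule scale n M S \<Longrightarrow> vhw \<in> S \<Longrightarrow> S = UNIV"
    and e_nilpotent: "i < n \<Longrightarrow> \<exists>N. (chev_e scale n M i ^^ N) v = 0"
    and f_nilpotent: "i < n \<Longrightarrow> \<exists>N. (chev_f scale n M i ^^ N) v = 0"

definition level :: "(base \<Rightarrow> 'v \<Rightarrow> 'v) \<Rightarrow> 'v currents \<Rightarrow> nat \<Rightarrow> bool" where
  "level scale M k \<longleftrightarrow> (\<forall>j v. qc M j v = scale (qhalf powi (int k * j)) v)"

text \<open>The algebra is graded by the affine root lattice: \<open>xi(l)\<close> has degree \<open>\<plusminus> \<alpha>i + l \<delta>\<close>, and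
  \<open>\<phi>i(m)\<close>, \<open>\<psi>i(m)\<close> have degree \<open>m \<delta>\<close>.  The weight space of weight \<open>\<lambda> + \<Sum>i. \<beta> i \<alpha>i + d \<delta>\<close> of a
  module with highest weight vector \<open>vhw\<close> of weight \<open>\<lambda>\<close> is the image of \<open>vhw\<close> under the component
  of the corresponding degree.  The eigenvalues of the \<open>\<psi>i(0)\<close> alone do not see \<open>d\<close>.\<close>

inductive weight_vector ::
  "(base \<Rightarrow> 'v \<Rightarrow> 'v::ab_group_add) \<Rightarrow> nat \<Rightarrow> 'v currents \<Rightarrow> 'v \<Rightarrow> (nat \<Rightarrow> int) \<Rightarrow> int \<Rightarrow> 'v \<Rightarrow> bool"
  for scale n M vhw
where
  highest: "weight_vector scale n M vhw (\<lambda>_. 0) 0 vhw"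
| cur: "weight_vector scale n M vhw \<beta> d v \<Longrightarrow> i \<in> {1..<n} \<Longrightarrow>
    weight_vector scale n M vhw (\<beta>(i := \<beta> i + sgn_pm e)) (d + l) (cur M e i l v)"
| phi: "weight_vector scale n M vhw \<beta> d v \<Longrightarrow> i \<in> {1..<n} \<Longrightarrow>
    weight_vector scale n M vhw \<beta> (d - int m) (phi M i m v)"
| psi: "weight_vector scale n M vhw \<beta> d v \<Longrightarrow> i \<in> {1..<n} \<Longrightarrow>
    weight_vector scale n M vhw \<beta> (d + int m) (psi M i m v)"
| qc: "weight_vector scale n M vhw \<beta> d v \<Longrightarrow> weight_vector scale n M vhw \<beta> d (qc M j v)"
| zero: "weight_vector scale n M vhw \<beta> d 0"
| add: "weight_vector scale n M vhw \<beta> d v \<Longrightarrow> weight_vector scale n M vhw \<beta> d v' \<Longrightarrow>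
    weight_vector scale n M vhw \<beta> d (v + v')"
| scale: "weight_vector scale n M vhw \<beta> d v \<Longrightarrow> weight_vector scale n M vhw \<beta> d (scale a v)"

definition weight_space ::
  "(base \<Rightarrow> 'v \<Rightarrow> 'v::ab_group_add) \<Rightarrow> nat \<Rightarrow> 'v currents \<Rightarrow> 'v \<Rightarrow> (nat \<Rightarrow> int) \<Rightarrow> int \<Rightarrow> 'v set" where
  "weight_space scale n M vhw \<beta> d = {v. weight_vector scale n M vhw \<beta> d v}"

definition restricted_dual ::
  "(base \<Rightarrow> 'v \<Rightarrow> 'v::ab_group_add) \<Rightarrow> nat \<Rightarrow> 'v currents \<Rightarrow> 'v \<Rightarrow> ('v \<Rightarrow> base) set" where
  "restricted_dual scale n M vhw =
     {f. Vector_Spaces.linear scale (*) f \<and>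
         finite {(\<beta>, d). \<exists>v\<in>weight_space scale n M vhw \<beta> d. f v \<noteq> 0}}"

text \<open>Coefficient of \<open>z\<close> to the \<open>- k\<close>, \<open>w\<close> to the \<open>- l\<close> in the matrix coefficient of
  \<open>A(z) B(w)\<close>.\<close>

definition correlation ::
  "('v \<Rightarrow> base) \<Rightarrow> (int \<Rightarrow> 'v \<Rightarrow> 'v) \<Rightarrow> (int \<Rightarrow> 'v \<Rightarrow> 'v) \<Rightarrow> 'v \<Rightarrow> int \<Rightarrow> int \<Rightarrow> base" where
  "correlation f A B v k l = f (A k (B l v))"

text \<open>Polynomials in \<open>z\<close> and \<open>w\<close> are polynomials in \<open>w\<close> (outer) over polynomials in \<open>z\<close> (inner).\<close>

definition eval2 :: "('a::zero \<Rightarrow> 'b) \<Rightarrow> 'b \<Rightarrow> 'b \<Rightarrow> 'a poly poly \<Rightarrow> 'b::comm_semiring_0" where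
  "eval2 h z w P = poly (map_poly (\<lambda>p. poly (map_poly h p) z) P) w"

text \<open>Expansion in the region where \<open>z\<close> dominates \<open>w\<close>: in the field of Laurent series in \<open>w\<close>
  over the field of Laurent series in the inverse of \<open>z\<close>.\<close>

definition laurent_of :: "'a::field poly poly \<Rightarrow> 'a fls fls" where
  "laurent_of = eval2 (\<lambda>c. fls_const (fls_const c)) (fls_const fls_X_inv) fls_X"

text \<open>Here \<open>C k l\<close> is the coefficient of \<open>z\<close> to the \<open>- k\<close>, \<open>w\<close> to the \<open>- l\<close>.\<close>

definition is_expansion_of :: "(int \<Rightarrow> int \<Rightarrow> 'a) \<Rightarrow> 'a::field poly poly fract \<Rightarrow> bool" where
  "is_expansion_of C R \<longleftrightarrow>
     (\<exists>P Q. Q \<noteq> 0 \<and> R = Fract P Q \<and>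
        (\<forall>k l. C k l = fls_nth (fls_nth (laurent_of P / laurent_of Q) (- l)) k))"

text \<open>Points have coordinates in the algebraic closure of the base field.\<close>

definition pole_at :: "'a::field poly poly fract \<Rightarrow> 'a alg_closure \<Rightarrow> 'a alg_closure \<Rightarrow> bool" where
  "pole_at R z w \<longleftrightarrow> \<not> (\<exists>P Q. R = Fract P Q \<and> eval2 to_ac z w Q \<noteq> 0)"

text \<open>The only poles with nonzero coordinates lie on the locus \<open>z a = w\<close>.\<close>

definition at_most_poles_at :: "(int \<Rightarrow> int \<Rightarrow> 'a) \<Rightarrow> 'a::field \<Rightarrow> bool" where
  "at_most_poles_at C a \<longleftrightarrow>
     (\<exists>R. is_expansion_of C R \<and>
        (\<forall>z w. z \<noteq> 0 \<longrightarrow> w \<noteq> 0 \<longrightarrow> pole_at R z w \<longrightarrow> z * to_ac a = w))"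

end

theory Submission
  imports Defs
begin

text \<open>The relation between two currents of the same sign says that \<open>(z - b w) x\<^sub>i(z) x\<^sub>j(w)\<close>, where
  \<open>b\<close> is a power of \<open>q\<close>, equals \<open>(b z - w) x\<^sub>j(w) x\<^sub>i(z)\<close>.  If every vector is killed by all large
  modes, a matrix coefficient of the left-hand side has bounded powers of \<open>w\<inverse>\<close>, one of the right-hand
  side has bounded powers of \<open>z\<inverse>\<close>, and the total degree is bounded by the grading; hence it is a
  Laurent polynomial, and only the pole \<open>z = b w\<close> is possible.

  The vectors killed by all large modes of the currents and of the \<open>\<psi>\<^sub>i\<close> form a submodule, so it is
  enough to treat the highest weight vector \<open>v\<close>.  There, \<open>e\<^sub>0 v = 0\<close> says that an iterated
  \<open>q\<close>-commutator of the \<open>x\<^sup>-\<^sub>j\<close> kills \<open>v\<close>; commuting it with the \<open>x\<^sup>+\<^sub>j(0)\<close> yields \<open>x\<^sup>-\<^sub>i(1) v = 0\<close> for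
  all \<open>i\<close>.  Then \<open>\<psi>\<^sub>i(1) v = 0\<close>, and commuting with \<open>\<psi>\<^sub>i(1)\<close> raises the modes that kill \<open>v\<close>.\<close>

section \<open>Expansions with a single pole\<close>

lemma eval2_monom_monom:
  fixes h :: "'a::zero \<Rightarrow> 'b::comm_semiring_1"
  assumes "h 0 = 0"
  shows "eval2 h z w (monom (monom c a) b) = h c * z ^ a * w ^ b"
  using assms by (simp add: eval2_def map_poly_monom poly_monom)

lemma map_poly_add:
  assumes "h 0 = 0" and "\<And>x y. h (x + y) = h x + h y"
  shows "map_poly h (p + p') = map_poly h p + map_poly h p'"
  by (intro poly_eqI) (simp add: coeff_map_poly assms)

lemma eval2_add:
  assumes "h 0 = 0" and "\<And>x y. h (x + y) = h x + h y"
  shows "eval2 h z w (P + P') = eval2 h z w P + eval2 h z w P'"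
  unfolding eval2_def by (subst map_poly_add) (simp_all add: map_poly_add assms)

lemma eval2_sum:
  assumes "h 0 = 0" and "\<And>x y. h (x + y) = h x + h y"
  shows "eval2 h z w (\<Sum>s\<in>S. P s) = (\<Sum>s\<in>S. eval2 h z w (P s))"
proof (induction S rule: infinite_finite_induct)
  case (insert s S)
  then show ?case by (simp add: eval2_add assms)
qed (simp_all add: eval2_def)

lemma laurent_of_monom_monom:
  "laurent_of (monom (monom c a) b) = fls_const (fls_const c * fls_X_inv ^ a) * fls_X ^ b"
  unfolding laurent_of_def
  by (subst eval2_monom_monom) (simp_all flip: fls_const_mult_const fls_const_power)

lemma laurent_of_add: "laurent_of (P + P') = laurent_of P + laurent_of P'"
  unfolding laurent_of_def by (rule eval2_add) (simp_all add: fls_plus_const)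

lemma laurent_of_sum: "laurent_of (\<Sum>s\<in>S. P s) = (\<Sum>s\<in>S. laurent_of (P s))"
  unfolding laurent_of_def by (rule eval2_sum) (simp_all add: fls_plus_const)

text \<open>The inner series variable is the inverse of z, so z^a sits at index -a.\<close>

lemma laurent_of_monom_monom_nth:
  "fls_nth (fls_nth (laurent_of (monom (monom c a) b)) m) k =
     (if m = int b \<and> k = - int a then c else 0)"
  by (simp add: laurent_of_monom_monom)

lemma laurent_of_monom_monom_times_nth:
  "fls_nth (fls_nth (laurent_of (monom (monom c a) b) * F) m) k =
     c * fls_nth (fls_nth F (m - int b)) (k + int a)"
  by (simp add: laurent_of_monom_monom fls_X_power_conv_shift_1 fls_X_inv_power_conv_shift_1
      fls_shifted_times_simps mult.assoc)

lemma fls_sum_nth: "fls_nth (\<Sum>s\<in>S. F s) m = (\<Sum>s\<in>S. fls_nth (F s) m)"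
  by (induction S rule: infinite_finite_induct) auto

text \<open>If \<open>(z - b w) C(z, w)\<close> is a Laurent polynomial, clearing its negative powers of \<open>z\<close> and
  \<open>w\<close> exhibits \<open>C\<close> as the expansion of a rational function.\<close>

lemma at_most_poles_atI:
  fixes C :: "int \<Rightarrow> int \<Rightarrow> 'a::field"
  assumes "b \<noteq> 0"
    and fin: "finite {(k, l). C (k + 1) l - b * C k (l + 1) \<noteq> 0}"
    and w_bound: "\<And>k l. l > L \<Longrightarrow> C k l = 0"
    and z_bound: "\<And>l. \<exists>K. \<forall>k<K. C k l = 0"
  shows "at_most_poles_at C (inverse b)"
proof -
  define E where "E = (\<lambda>k l. C (k + 1) l - b * C k (l + 1))"
  define S where "S = {(k, l). E k l \<noteq> 0}"
  have S: "finite S" using fin by (simp add: S_def E_def)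
  \<comment> \<open>\<open>A\<close> and \<open>B\<close> bound the powers of 1/z and 1/w in the
    Laurent polynomial with coefficients \<open>E\<close>, so that multiplying it by z^A w^B gives
    the polynomial \<open>P\<close>. Inserting 0 covers an empty \<open>S\<close> and makes
    \<open>nat\<close> harmless.\<close>
  define A where "A = nat (Max (insert 0 (fst ` S)))"
  define B where "B = nat (Max (insert 0 (snd ` S)))"
  have A: "k \<le> int A" if "(k, l) \<in> S" for k l
  proof -
    have "k \<le> Max (insert 0 (fst ` S))" using S that by (intro Max_ge) force+
    then show ?thesis by (simp add: A_def)
  qed
  have B: "l \<le> int B" if "(k, l) \<in> S" for k l
  proof -
    have "l \<le> Max (insert 0 (snd ` S))" using S that by (intro Max_ge) force+
    then show ?thesis by (simp add: B_def)
  qed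
  have A': "int (nat (int A - k)) = int A - k" if "(k, l) \<in> S" for k l
    using A[OF that] by simp
  have B': "int (nat (int B - l)) = int B - l" if "(k, l) \<in> S" for k l
    using B[OF that] by simp
  define P where
    "P = (\<Sum>(k, l)\<in>S. monom (monom (E k l) (nat (int A - k))) (nat (int B - l)))"
  \<comment> \<open>This is z^A w^B (z - b w).\<close>
  define Q where
    "Q = monom (monom 1 (Suc A)) B + monom (monom (- b) A) (Suc B)"
  \<comment> \<open>Both levels are genuine Laurent series: the outer one by \<open>w_bound\<close>,
    the inner ones by \<open>z_bound\<close>.\<close>
  define F where "F = Abs_fls (\<lambda>m. Abs_fls (\<lambda>k. C k (- m)))"
  have inner: "fls_nth (Abs_fls (\<lambda>k. C k l)) k = C k l" for k l
    by (rule nth_Abs_fls_ex_lower_bound) (rule z_bound)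
  have "fls_nth F m = Abs_fls (\<lambda>k. C k (- m))" for m
    unfolding F_def
  proof (rule nth_Abs_fls_ex_lower_bound, intro exI allI impI)
    fix m assume "m < - L"
    then show "Abs_fls (\<lambda>k. C k (- m)) = 0"
      by (intro fls_eqI) (simp add: inner w_bound)
  qed
  then have F: "fls_nth (fls_nth F m) k = C k (- m)" for m k by (simp add: inner)
  have Q_nz: "Q \<noteq> 0"
  proof
    assume "Q = 0"
    then have "coeff (coeff Q B) (Suc A) = 0" by simp
    then show False by (simp add: Q_def)
  qed
  have "laurent_of Q * F = laurent_of P"
  proof (intro fls_eqI)
    fix m k
    have "fls_nth (fls_nth (laurent_of Q * F) m) k = E (k + int A) (int B - m)"
      by (simp add: Q_def laurent_of_add distrib_right laurent_of_monom_monom_times_nth F E_def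
          add_ac add_diff_eq)
    also have "\<dots> = (\<Sum>s\<in>S. if s = (k + int A, int B - m) then E (k + int A) (int B - m) else 0)"
      using S by (simp add: S_def)
    also have "\<dots> = (\<Sum>(k', l)\<in>S. if m = int B - l \<and> k = - (int A - k') then E k' l else 0)"
      by (intro sum.cong) (auto split: if_splits)
    also have "\<dots> = (\<Sum>(k', l)\<in>S. if m = int (nat (int B - l)) \<and> k = - int (nat (int A - k'))
        then E k' l else 0)"
      by (intro sum.cong refl) (clarsimp simp only: A' B')
    also have "\<dots> = fls_nth (fls_nth (laurent_of P) m) k"
      by (simp add: P_def laurent_of_sum fls_sum_nth laurent_of_monom_monom_nth case_prod_unfold)
    finally show "fls_nth (fls_nth (laurent_of Q * F) m) k = fls_nth (fls_nth (laurent_of P) m) k" .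
  qed
  moreover have "laurent_of Q \<noteq> 0"
  proof
    assume "laurent_of Q = 0"
    then have "fls_nth (fls_nth (laurent_of Q) (int B)) (- int (Suc A)) = 0" by simp
    then show False by (simp add: Q_def laurent_of_add laurent_of_monom_monom_nth del: of_nat_Suc)
  qed
  ultimately have "laurent_of P / laurent_of Q = F"
    by (metis nonzero_mult_div_cancel_left)
  then have "is_expansion_of C (Fract P Q)"
    unfolding is_expansion_of_def using Q_nz F by (intro exI[of _ P] exI[of _ Q]) simp
  moreover have "z * to_ac (inverse b) = w"
    if "z \<noteq> 0" "w \<noteq> 0" "pole_at (Fract P Q) z w" for z w
  proof -
    \<comment> \<open>The denominator of every representation vanishes at a pole; for nonzero z and
      w only the factor z - b w of \<open>Q\<close> can.\<close>
    have "eval2 to_ac z w Q = 0" using that(3) unfolding pole_at_def by blast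
    moreover have "eval2 to_ac z w Q = z ^ A * w ^ B * (z - to_ac b * w)"
      unfolding Q_def by (subst eval2_add) (simp_all add: eval2_monom_monom algebra_simps)
    ultimately have "z = to_ac b * w" using that by simp
    then show ?thesis using \<open>b \<noteq> 0\<close> by simp
  qed
  ultimately show ?thesis unfolding at_most_poles_at_def by blast
qed

section \<open>Structure functions and modes of the currents\<close>

lemma qhalf_power: "qhalf ^ m = Fract (monom 1 m) 1"
proof (induction m)
  case 0
  then show ?case by (simp add: One_fract_def monom_0 one_pCons)
next
  case (Suc m)
  have "qhalf ^ Suc m = Fract ([:0, 1:] * monom 1 m) 1"
    using Suc by (simp add: qhalf_def)
  also have "[:0, 1:] * monom 1 m = monom (1 :: complex) (Suc m)"
    by (simp add: monom_Suc)
  finally show ?case .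
qed

lemma qhalf_nonzero [simp]: "qhalf \<noteq> 0"
  by (simp add: qhalf_def Zero_fract_def eq_fract)

lemma q_nonzero [simp]: "q \<noteq> 0"
  by (simp add: q_def)

text \<open>\<open>q\<close> is the square of an indeterminate, so a degree count shows that it is
  not a root of unity.\<close>

lemma q_power_eq_1: "q ^ m = 1 \<Longrightarrow> m = 0"
proof -
  assume "q ^ m = 1"
  then have "Fract (monom 1 (2 * m)) 1 = (1 :: base)"
    by (simp add: q_def flip: qhalf_power power_mult)
  then have "monom (1 :: complex) (2 * m) = 1" by (simp add: One_fract_def eq_fract)
  then have "degree (monom (1 :: complex) (2 * m)) = 0" by simp
  then show "m = 0" by (simp add: degree_monom_eq)
qed

lemma q_powi_eq_1_iff [simp]: "q powi z = 1 \<longleftrightarrow> z = 0"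
  by (cases z rule: int_cases4) (auto simp: power_int_minus dest: q_power_eq_1)

lemma q_minus_inverse_nonzero [simp]: "q - inverse q \<noteq> 0"
proof
  assume "q - inverse q = 0"
  then have "q powi 2 = 1" by (simp add: field_simps power2_eq_square)
  then show False by (simp only: q_powi_eq_1_iff)
qed

lemma g_times: "g i j * (fps_X - fps_const (q powi cartan i j)) = fps_const (q powi cartan i j) * fps_X - 1"
  unfolding g_def mult.assoc by (subst inverse_mult_eq_1) simp_all

lemma g_nth_0: "fps_nth (g i j) 0 = q powi (- cartan i j)"
  using arg_cong[OF g_times[of i j], of "\<lambda>f. fps_nth f 0"]
  by (simp add: power_int_minus field_simps)

lemma g_inverse_times:
  "inverse (g i j) * (fps_const (q powi cartan i j) * fps_X - 1) = fps_X - fps_const (q powi cartan i j)"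
  unfolding g_times[symmetric] mult.assoc[symmetric]
  by (subst inverse_mult_eq_1) (simp_all add: g_nth_0)

lemma g_pm_nth_0: "fps_nth (g_pm e i j) 0 = q powi (- sgn_pm e * cartan i j)"
  by (cases e) (simp_all add: g_nth_0 power_int_minus)

lemma g_pm_nth_0_nonzero [simp]: "fps_nth (g_pm e i j) 0 \<noteq> 0"
  by (simp only: g_pm_nth_0) simp

text \<open>With b the power of \<open>q\<close> in \<open>g\<close>, comparing coefficients in
  \<open>g_times\<close> and \<open>g_inverse_times\<close> gives recursions that are geometric from
  index 1 on. The coefficients at index 1 are nonzero because b^2 is not 1. This permits dividing by
  them in \<open>cur_neg\<close> and \<open>cur_raise\<close>.\<close>

lemma g_nth_nonzero:
  assumes "cartan i j \<noteq> 0"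
  shows "fps_nth (g i j) m \<noteq> 0" and "fps_nth (inverse (g i j)) m \<noteq> 0"
proof -
  let ?b = "q powi cartan i j"
  have "q powi (cartan i j + cartan i j) \<noteq> 1" using assms by simp
  then have b: "?b * ?b \<noteq> 1" by (subst (asm) power_int_add) simp_all
  have eq: "fps_nth (g i j * fps_X) m - fps_nth (g i j) m * ?b = fps_nth (fps_const ?b * fps_X - 1) m" for m
    using arg_cong[OF g_times[of i j], of "\<lambda>f. fps_nth f m"] by (simp add: algebra_simps)
  have g1: "fps_nth (g i j) (Suc m) \<noteq> 0" for m
  proof (induction m)
    case 0
    then show ?case using eq[of 1] b by (auto simp: g_nth_0 power_int_minus field_simps)
  next
    case (Suc m)
    then show ?case using eq[of "Suc (Suc m)"] by auto
  qed
  show "fps_nth (g i j) m \<noteq> 0" by (cases m) (simp_all add: g1 g_nth_0)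
  let ?h = "inverse (g i j)"
  have "?h * (fps_const ?b * fps_X - 1) = fps_const ?b * (?h * fps_X) - ?h"
    by (simp add: algebra_simps)
  then have eq: "?b * fps_nth (?h * fps_X) m - fps_nth ?h m = fps_nth (fps_X - fps_const ?b) m" for m
    by (metis g_inverse_times fps_sub_nth fps_mult_left_const_nth)
  have h1: "fps_nth ?h (Suc m) \<noteq> 0" for m
  proof (induction m)
    case 0
    then show ?case using eq[of 1] b by (auto simp: g_nth_0 power_int_minus field_simps)
  next
    case (Suc m)
    then show ?case using eq[of "Suc (Suc m)"] by auto
  qed
  show "fps_nth ?h m \<noteq> 0" by (cases m) (simp_all add: h1 g_nth_0)
qed

lemma g_pm_nth_nonzero: "cartan i j \<noteq> 0 \<Longrightarrow> fps_nth (g_pm e i j) m \<noteq> 0"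
  by (cases e) (simp_all add: g_nth_nonzero)

lemma g_pm_orthogonal: "cartan i j = 0 \<Longrightarrow> g_pm e i j = 1"
  using inverse_mult_eq_1'[of "fps_X - 1 :: base fps"] by (cases e) (simp_all add: g_def)

section \<open>Modules on which the central element acts by a scalar\<close>

lemma (in drinfeld_module) linear_rules:
  assumes "Vector_Spaces.linear scale scale f"
  shows "f 0 = 0" and "f (x + y) = f x + f y" and "f (x - y) = f x - f y"
    and "f (scale a x) = scale a (f x)"
proof -
  interpret Vector_Spaces.linear scale scale f by fact
  show "f 0 = 0" "f (x + y) = f x + f y" "f (x - y) = f x - f y"
    "f (scale a x) = scale a (f x)"
    by (simp_all add: add diff local.scale)
qed

locale level_module = drinfeld_module scale n M
  for scale :: "base \<Rightarrow> 'v \<Rightarrow> 'v::ab_group_add" and n and M +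
  fixes c :: nat
  assumes level: "level scale M c"
begin

lemma qc_scale [simp]: "qc M j v = scale (qhalf powi (int c * j)) v"
  using level by (simp add: level_def)

lemmas psi_rules [simp] = linear_rules[OF psi_linear]
lemmas phi_rules [simp] = linear_rules[OF phi_linear]

text \<open>The variable \<open>l\<close> is shared by all assumptions of \<open>drinfeld_module\<close> and has type \<open>nat\<close>, so that
  they do not mention the modes \<open>l < 0\<close> of a current in that position.  These modes are recovered from the
  mode \<open>0\<close> through the relation between \<open>\<phi>\<close> and the current.\<close>

lemma cur_neg:
  fixes e :: pm
  assumes i: "i \<in> {1..<n}"
  defines "a \<equiv> \<lambda>r. fps_nth (g_pm e i i) r * qhalf powi (int c * (- sgn_pm e * int r))"
  shows "cur M e i (- int m) v = scale (inverse (a m)) (phi M i m (cur M e i 0 (psi M i 0 v))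
    - (\<Sum>r<m. scale (a r) (cur M e i (- int r) (phi M i (m - r) (psi M i 0 v)))))"
proof -
  have "a m \<noteq> 0"
    using g_pm_nth_nonzero[of i i e m] by (simp add: a_def cartan_def)
  \<comment> \<open>Starting from \<open>psi M i 0 v\<close> turns the last summand, where
    \<open>phi M i 0\<close> acts, into a multiple of the wanted mode applied to
    \<open>v\<close>.\<close>
  moreover have "phi M i m (cur M e i 0 (psi M i 0 v)) =
      (\<Sum>r<m. scale (a r) (cur M e i (- int r) (phi M i (m - r) (psi M i 0 v))))
      + scale (a m) (cur M e i (- int m) v)"
    using phi_cur[OF i i, of m e 0 "psi M i 0 v"] i
    by (simp add: a_def lessThan_Suc_atMost[symmetric] phi_0_psi_0 del: g_pm.simps sgn_pm.simps)
  ultimately show ?thesis by simp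
qed

lemma linearI:
  "(\<And>x y. f (x + y) = f x + f y) \<Longrightarrow> (\<And>a x. f (scale a x) = scale a (f x)) \<Longrightarrow>
    Vector_Spaces.linear scale scale f"
  by (simp add: Vector_Spaces.linear_def module_hom_def module_hom_axioms_def vector_space_axioms
      module_axioms)

lemma cur_linear_neg:
  assumes i: "i \<in> {1..<n}"
  shows "Vector_Spaces.linear scale scale (cur M e i (- int m))"
proof (induction m rule: less_induct)
  case (less m)
  note [simp] = linear_rules[OF less] linear_rules[OF cur_linear[OF i, of _ 0], simplified]
  show ?case
    by (rule linearI) (use i in \<open>simp_all add: cur_neg[OF i, of e m] sum.distrib scale_right_distrib
        scale_right_diff_distrib scale_sum_right mult.commute algebra_simps\<close>)
qed

lemma cur_linear_int: "i \<in> {1..<n} \<Longrightarrow> Vector_Spaces.linear scale scale (cur M e i l)"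
  using cur_linear[of i e "nat l"] cur_linear_neg[of i e "nat (- l)"] by (cases "l \<ge> 0") auto

lemmas cur_rules [simp] = linear_rules[OF cur_linear_int]

text \<open>Exchanging the two currents, and \<open>k\<close> with \<open>l\<close>, turns the
  relation into itself up to sign, so \<open>cur_cur\<close> yields it whenever one of the two modes
  is nonnegative.\<close>

lemma cur_cur_int:
  assumes "i \<in> {1..<n}" "j \<in> {1..<n}" and kl: "k \<ge> 0 \<or> l \<ge> 0"
  shows "cur M e i (k + 1) (cur M e j l v)
        - scale (q powi (sgn_pm e * cartan i j)) (cur M e i k (cur M e j (l + 1) v)) =
      scale (q powi (sgn_pm e * cartan i j)) (cur M e j l (cur M e i (k + 1) v))
        - cur M e j (l + 1) (cur M e i k v)"
proof (cases "l \<ge> 0")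
  case True
  then show ?thesis using cur_cur[OF assms(1,2), of e k "nat l" v] by (simp add: add.commute)
next
  case False
  have "cartan j i = cartan i j" by (auto simp: cartan_def)
  moreover have "int (nat k) = k" using kl False by simp
  ultimately show ?thesis using cur_cur[OF assms(2,1), of e l "nat k" v]
    by (simp add: algebra_simps)
qed

lemma psi_cur_orthogonal:
  assumes "i \<in> {1..<n}" "j \<in> {1..<n}" "cartan i j = 0"
  shows "psi M i m (cur M e j (int l) v) = cur M e j (int l) (psi M i m v)"
proof -
  have "psi M i m (cur M e j (int l) v) =
      (\<Sum>r\<le>m. if r = 0 then cur M e j (int l) (psi M i m v) else 0)"
    unfolding psi_cur[OF assms(1,2)]
    by (intro sum.cong) (use assms in \<open>simp_all add: g_pm_orthogonal\<close>)
  then show ?thesis by simp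
qed

lemma psi_0_cur:
  assumes "i \<in> {1..<n}" "j \<in> {1..<n}"
  shows "psi M i 0 (cur M e j (int l) v) =
    scale (q powi (sgn_pm e * cartan i j)) (cur M e j (int l) (psi M i 0 v))"
  using psi_cur[OF assms, of 0 e l v] assms by (cases e; simp add: g_pm_nth_0 del: g_pm.simps)+

lemma phi_0_cur:
  assumes "i \<in> {1..<n}" "j \<in> {1..<n}"
  shows "phi M i 0 (cur M e j (int l) v) =
    scale (q powi (- sgn_pm e * cartan i j)) (cur M e j (int l) (phi M i 0 v))"
  using phi_cur[OF assms, of 0 e l v] assms by (cases e; simp add: g_pm_nth_0 del: g_pm.simps)+

text \<open>\<open>\<phi>\<^sub>i\<close> has no modes of positive index, so the commutator of
  \<open>x\<^sup>+\<^sub>i(0)\<close> and \<open>x\<^sup>-\<^sub>i(m)\<close> is a nonzero multiple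
  of \<open>\<psi>\<^sub>i(m)\<close>.\<close>

lemma psi_eq_0:
  assumes i: "i \<in> {1..<n}" and "m \<noteq> 0"
    and "cur M Pos i 0 v = 0" "cur M Neg i (int m) v = 0"
  shows "psi M i m v = 0"
  using cur_Pos_Neg[OF i i, of 0 m v] assms
    q_minus_inverse_nonzero
  by (simp add: psi_mode_def phi_mode_def del: q_minus_inverse_nonzero)

text \<open>Moving \<open>\<psi>\<^sub>j(1)\<close> past \<open>x\<^sub>i(l)\<close> leaves a
  multiple of \<open>x\<^sub>i(l + 1)\<close> applied to \<open>\<psi>\<^sub>j(0) v\<close>; its
  coefficient is nonzero as the indices are not orthogonal.\<close>

lemma cur_raise:
  assumes i: "i \<in> {1..<n}" and j: "j \<in> {1..<n}" and nz: "cartan j i \<noteq> 0"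
    and "psi M j 1 v = 0" and "psi M j 1 (cur M e i (int l) v) = 0"
    and "psi M j 0 v = scale s v" "s \<noteq> 0"
  shows "cur M e i (int (Suc l)) v = 0"
  using psi_cur[OF j i, of 1 e l v] assms g_pm_nth_nonzero[OF nz, of "opp e" 1]
  by (simp add: add.commute)

end

section \<open>Vectors killed by all large modes\<close>

text \<open>The conjunct \<open>r \<le> l\<close> keeps subtraction on the naturals in agreement
  with that of the integer modes.\<close>

lemma eventually_sequentially_diff:
  "eventually P sequentially \<Longrightarrow> \<forall>\<^sub>F l in sequentially. r \<le> l \<and> P (l - r)"
proof -
  assume "eventually P sequentially"
  then obtain N where "\<And>l. l \<ge> N \<Longrightarrow> P l" unfolding eventually_sequentially by blast
  then have "r \<le> l \<and> P (l - r)" if "l \<ge> N + r" for l using that by simp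
  then show ?thesis unfolding eventually_sequentially by blast
qed

lemma sum_eq_first:
  fixes m :: nat
  shows "(\<And>r. 1 \<le> r \<Longrightarrow> r \<le> m \<Longrightarrow> F r = 0) \<Longrightarrow> (\<Sum>r\<le>m. F r) = F 0"
  by (simp add: sum.atMost_shift)

context level_module
begin

text \<open>The modes of \<open>psi\<close> are included because commutators of opposite currents
  produce them.\<close>

definition truncated :: "'v \<Rightarrow> bool" where
  "truncated v \<longleftrightarrow> (\<forall>\<^sub>F m in sequentially.
     \<forall>i\<in>{1..<n}. (\<forall>e. cur M e i (int m) v = 0) \<and> psi M i m v = 0)"

lemma truncatedE:
  assumes "truncated v"
  obtains N where "\<And>i e m. i \<in> {1..<n} \<Longrightarrow> N \<le> m \<Longrightarrow> cur M e i (int m) v = 0"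
    and "\<And>i m. i \<in> {1..<n} \<Longrightarrow> N \<le> m \<Longrightarrow> psi M i m v = 0"
  using assms unfolding truncated_def eventually_sequentially by blast

lemma truncatedD:
  assumes "truncated v" "i \<in> {1..<n}"
  shows "\<forall>\<^sub>F m in sequentially. cur M e i (int m) v = 0"
    and "\<forall>\<^sub>F m in sequentially. psi M i m v = 0"
  using assms unfolding truncated_def by (auto elim: eventually_mono)

lemma truncatedI:
  assumes "\<And>i e. i \<in> {1..<n} \<Longrightarrow> \<forall>\<^sub>F m in sequentially. cur M e i (int m) v = 0"
    and "\<And>i. i \<in> {1..<n} \<Longrightarrow> \<forall>\<^sub>F m in sequentially. psi M i m v = 0"
  shows "truncated v"
  unfolding truncated_def
proof (rule eventually_ball_finite, safe)
  fix i assume "i \<in> {1..<n}"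
  then have "\<forall>\<^sub>F m in sequentially. cur M Pos i (int m) v = 0 \<and> cur M Neg i (int m) v = 0
      \<and> psi M i m v = 0"
    by (intro eventually_conj assms)
  then show "\<forall>\<^sub>F m in sequentially. (\<forall>e. cur M e i (int m) v = 0) \<and> psi M i m v = 0"
    by eventually_elim (metis pm.exhaust)
qed

lemma subspace_truncated: "subspace {v. truncated v}"
proof (rule subspaceI)
  show "0 \<in> {v. truncated v}" by (simp add: truncated_def)
next
  fix x y assume "x \<in> {v. truncated v}" "y \<in> {v. truncated v}"
  then have "\<forall>\<^sub>F m in sequentially.
     \<forall>i\<in>{1..<n}. (\<forall>e. cur M e i (int m) (x + y) = 0) \<and> psi M i m (x + y) = 0"
    unfolding truncated_def mem_Collect_eq by eventually_elim simp
  then show "x + y \<in> {v. truncated v}" by (simp add: truncated_def)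
next
  fix a x assume "x \<in> {v. truncated v}"
  then have "\<forall>\<^sub>F m in sequentially.
     \<forall>i\<in>{1..<n}. (\<forall>e. cur M e i (int m) (scale a x) = 0) \<and> psi M i m (scale a x) = 0"
    unfolding truncated_def mem_Collect_eq by eventually_elim simp
  then show "scale a x \<in> {v. truncated v}" by (simp add: truncated_def)
qed

text \<open>Modes of one sign: the quadratic relation trades \<open>x\<^sub>i(l) x\<^sub>j(m) v\<close> for
  \<open>x\<^sub>i(l - 1) x\<^sub>j(m + 1) v\<close> as long as \<open>l - 1\<close> is so large that \<open>x\<^sub>i(l - 1) v\<close> vanishes.\<close>

lemma eventually_cur_cur_same:
  assumes "truncated v" and i: "i \<in> {1..<n}" and j: "j \<in> {1..<n}"
  shows "\<forall>\<^sub>F l in sequentially. cur M e i (int l) (cur M e j m v) = 0"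
proof -
  obtain N where N: "\<And>i e m. i \<in> {1..<n} \<Longrightarrow> N \<le> m \<Longrightarrow> cur M e i (int m) v = 0"
    using truncatedE[OF assms(1)] by metis
  \<comment> \<open>Here \<open>t\<close> bounds the number of trades after which the inner mode
    reaches \<open>N\<close> and kills \<open>v\<close>.\<close>
  have *: "cur M e i (int l) (cur M e j m v) = 0" if "int N \<le> m + int t" "Suc (N + t) \<le> l" for t m l
    using that
  proof (induction t arbitrary: m l)
    case 0
    then show ?case using N[OF j, of "nat m" e] i by simp
  next
    case (Suc t)
    then obtain l' where l: "l = Suc l'" "Suc (N + t) \<le> l'" by (cases l) auto
    have "cur M e i (int l') (cur M e j (m + 1) v) = 0" using Suc l by (intro Suc.IH) auto
    moreover have "cur M e i (int l' + 1) v = 0" "cur M e i (int l') v = 0"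
      using N[OF i, of "Suc l'" e] N[OF i, of l' e] l(2) by (simp_all add: add.commute)
    ultimately show ?case using cur_cur_int[OF i j, of "int l'" m e v] i j l(1)
      by (simp add: add.commute)
  qed
  have "cur M e i (int l) (cur M e j m v) = 0" if "l \<ge> Suc (N + nat (int N - m))" for l
    using that by (intro *[of m "nat (int N - m)"]) auto
  then show ?thesis unfolding eventually_sequentially by blast
qed

lemma eventually_cur_cur_opposite:
  assumes "truncated v" and i: "i \<in> {1..<n}" and j: "j \<in> {1..<n}"
  shows "\<forall>\<^sub>F l in sequentially. cur M e i (int l) (cur M (opp e) j (int m) v) = 0"
proof -
  obtain N where N: "\<And>i e m. i \<in> {1..<n} \<Longrightarrow> N \<le> m \<Longrightarrow> cur M e i (int m) v = 0"
      "\<And>i m. i \<in> {1..<n} \<Longrightarrow> N \<le> m \<Longrightarrow> psi M i m v = 0"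
    using truncatedE[OF assms(1)] by metis
  \<comment> \<open>The bound \<open>Suc N\<close> makes l + m positive, so the commutator contains
    no mode of \<open>phi\<close>.\<close>
  have "cur M e i (int l) (cur M (opp e) j (int m) v) = 0" if "l \<ge> Suc N" for l
  proof -
    have nat: "nat (int l + int m) = l + m" "nat (int m + int l) = m + l" by simp_all
    show ?thesis
    proof (cases e)
      case Pos
      then show ?thesis using cur_Pos_Neg[OF i j, of "int l" m v] that i j
        by (simp add: N psi_mode_def phi_mode_def nat split: if_splits)
    next
      case Neg
      then show ?thesis using cur_Pos_Neg[OF j i, of "int m" l v] that i j
        by (simp add: N psi_mode_def phi_mode_def nat split: if_splits)
    qed
  qed
  then show ?thesis unfolding eventually_sequentially by blast
qed

text \<open>For large l the relation expands 0 = \<open>\<psi>\<^sub>j(m) x\<^sub>i(l) v\<close>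
  into terms \<open>x\<^sub>i(l + r) \<psi>\<^sub>j(m - r) v\<close>. Those with r > 0 vanish by
  induction, and the one with r = 0 has a nonzero coefficient. The next two lemmas argue alike, with
  modes l - r.\<close>

lemma eventually_cur_psi:
  assumes "truncated v" and i: "i \<in> {1..<n}" and j: "j \<in> {1..<n}"
  shows "\<forall>\<^sub>F l in sequentially. cur M e i (int l) (psi M j m v) = 0"
proof (induction m rule: less_induct)
  case (less m)
  have "\<forall>\<^sub>F l in sequentially. \<forall>r\<in>{1..m}. cur M e i (int (l + r)) (psi M j (m - r) v) = 0"
    by (intro eventually_ball_finite ballI less
        sequentially_offset[where P = "\<lambda>l. cur M e i (int l) _ = 0"]) auto
  moreover note truncatedD(1)[OF assms(1) i, of e]
  ultimately show ?case
  proof eventually_elim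
    case (elim l)
    have "psi M j m (cur M e i (int l) v)
        = scale (fps_nth (g_pm (opp e) j i) 0) (cur M e i (int l) (psi M j m v))"
      unfolding psi_cur[OF j i] by (subst sum_eq_first) (use elim i j in simp_all)
    then show ?case using elim j by simp
  qed
qed

lemma eventually_cur_phi:
  assumes "truncated v" and i: "i \<in> {1..<n}" and j: "j \<in> {1..<n}"
  shows "\<forall>\<^sub>F l in sequentially. cur M e i (int l) (phi M j m v) = 0"
proof (induction m rule: less_induct)
  case (less m)
  have "\<forall>\<^sub>F l in sequentially. \<forall>r\<in>{1..m}.
      r \<le> l \<and> cur M e i (int (l - r)) (phi M j (m - r) v) = 0"
    by (intro eventually_ball_finite ballI eventually_sequentially_diff less) auto
  moreover note truncatedD(1)[OF assms(1) i, of e]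
  ultimately show ?case
  proof eventually_elim
    case (elim l)
    have *: "cur M e i (int l - int r) (phi M j (m - r) v) = 0" if "1 \<le> r" "r \<le> m" for r
      using elim(1) that by (metis atLeastAtMost_iff of_nat_diff)
    have "phi M j m (cur M e i (int l) v)
        = scale (fps_nth (g_pm e j i) 0) (cur M e i (int l) (phi M j m v))"
      unfolding phi_cur[OF j i]
      by (subst sum_eq_first) (use i j in \<open>simp_all add: *\<close>)
    then show ?case using elim j by simp
  qed
qed

lemma eventually_psi_phi:
  assumes "truncated v" and i: "i \<in> {1..<n}" and j: "j \<in> {1..<n}"
  shows "\<forall>\<^sub>F l in sequentially. psi M i l (phi M j m v) = 0"
proof (induction m rule: less_induct)
  case (less m)
  have "\<forall>\<^sub>F l in sequentially. \<forall>r\<in>{1..m}. r \<le> l \<and> psi M i (l - r) (phi M j (m - r) v) = 0"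
    by (intro eventually_ball_finite ballI eventually_sequentially_diff less) auto
  moreover note truncatedD(2)[OF assms(1) i]
  ultimately show ?case
  proof eventually_elim
    case (elim l)
    have "phi M j m (psi M i l v) = psi M i l (phi M j m v)"
      unfolding phi_psi[OF j i]
      by (subst sum_eq_first[of "min m l"])
        (use elim(1) i j in \<open>simp_all add: g_nth_0 power_int_minus\<close>)
    then show ?case using elim j by simp
  qed
qed

lemma truncated_cur:
  assumes v: "truncated v" and j: "j \<in> {1..<n}"
  shows "truncated (cur M e j (int m) v)"
proof (rule truncatedI)
  fix i e' assume i: "i \<in> {1..<n}"
  have "e' = e \<or> e = opp e'" by (cases e; cases e') auto
  then show "\<forall>\<^sub>F l in sequentially. cur M e' i (int l) (cur M e j (int m) v) = 0"
    using eventually_cur_cur_same[OF v i j] eventually_cur_cur_opposite[OF v i j] by auto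
next
  fix i assume i: "i \<in> {1..<n}"
  obtain N where N: "\<And>m. N \<le> m \<Longrightarrow> psi M i m v = 0"
    using truncatedE[OF v] i by metis
  have "\<forall>\<^sub>F l in sequentially. \<forall>s\<in>{..<N}. cur M e j (int l) (psi M i s v) = 0"
    by (intro eventually_ball_finite ballI eventually_cur_psi v j i) simp
  then obtain K where K: "\<And>l s. K \<le> l \<Longrightarrow> s < N \<Longrightarrow> cur M e j (int l) (psi M i s v) = 0"
    unfolding eventually_sequentially by blast
  \<comment> \<open>In the expansion into terms
    \<open>x\<^sub>j(m + r) \<psi>\<^sub>i(l - r) v\<close>, either l - r is at least
    \<open>N\<close>, or r exceeds \<open>K\<close>.\<close>
  have "psi M i l (cur M e j (int m) v) = 0" if "l \<ge> N + K" for l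
  proof -
    have "cur M e j (int m + int r) (psi M i (l - r) v) = 0" if "r \<le> l" for r
    proof (cases "l - r < N")
      case True
      then show ?thesis using K[of "m + r" "l - r"] \<open>l \<ge> N + K\<close> by simp
    next
      case False
      then show ?thesis using N j by simp
    qed
    then show ?thesis unfolding psi_cur[OF i j] by (intro sum.neutral) simp
  qed
  then show "\<forall>\<^sub>F l in sequentially. psi M i l (cur M e j (int m) v) = 0"
    unfolding eventually_sequentially by blast
qed

lemma truncated_psi:
  assumes v: "truncated v" and j: "j \<in> {1..<n}"
  shows "truncated (psi M j m v)"
proof (rule truncatedI)
  fix i e assume i: "i \<in> {1..<n}"
  show "\<forall>\<^sub>F l in sequentially. cur M e i (int l) (psi M j m v) = 0"
    by (rule eventually_cur_psi[OF v i j])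
  show "\<forall>\<^sub>F l in sequentially. psi M i l (psi M j m v) = 0"
    using truncatedD(2)[OF v i] by eventually_elim (use psi_psi[OF i j] j in simp)
qed

lemma truncated_phi:
  assumes v: "truncated v" and j: "j \<in> {1..<n}"
  shows "truncated (phi M j m v)"
  by (rule truncatedI) (rule eventually_cur_phi[OF v _ j] eventually_psi_phi[OF v _ j], assumption)+

text \<open>By \<open>cur_neg\<close>, a negative mode is built from the operators already treated
  and from modes closer to 0.\<close>

lemma truncated_cur_neg:
  assumes j: "j \<in> {1..<n}"
  shows "truncated v \<Longrightarrow> truncated (cur M e j (- int m) v)"
proof (induction m arbitrary: v rule: less_induct)
  case (less m)
  note subspace = subspace_scale subspace_diff subspace_sum
  note in_subspace = subspace[OF subspace_truncated, unfolded mem_Collect_eq]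
  show ?case
    unfolding cur_neg[OF j, of e m v]
    by (intro in_subspace) (use less truncated_cur[OF _ j, of _ e 0]
        in \<open>auto intro!: truncated_phi truncated_psi j\<close>)
qed

lemma submodule_truncated: "submodule scale n M {v. truncated v}"
proof -
  have "truncated (cur M e i l v)" if "truncated v" "i \<in> {1..<n}" for e i l v
    using truncated_cur[OF that, of e "nat l"] truncated_cur_neg[OF that(2,1), of e "nat (- l)"]
    by (cases "l \<ge> 0") auto
  then show ?thesis
    using subspace_truncated subspace_scale[OF subspace_truncated] truncated_phi truncated_psi
    by (auto simp: submodule_def)
qed

end

section \<open>The highest weight vector\<close>

lemma theta_cur_2: "theta_cur scale 2 M e l = cur M e 1 l"
  by (simp add: theta_cur_def)

lemma theta_cur_Suc:
  assumes "2 \<le> m"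
  shows "theta_cur scale (Suc m) M e l v = cur M e m 0 (theta_cur scale m M e l v)
    - scale (inverse q) (theta_cur scale m M e l (cur M e m 0 v))"
  using assms by (simp add: theta_cur_def upt_Suc_append)

context level_module
begin

text \<open>These are the initial stages of the iterated commutator: \<open>theta 2\<close> is
  \<open>x\<^sup>-\<^sub>1(1)\<close>, and \<open>theta n\<close> is the one in
  \<open>e\<^sub>0\<close>.\<close>

abbreviation theta :: "nat \<Rightarrow> 'v \<Rightarrow> 'v" where
  "theta m \<equiv> theta_cur scale m M Neg 1"

lemma theta_scale:
  assumes "2 \<le> m" "m \<le> n"
  shows "theta m (scale a w) = scale a (theta m w)"
  using assms
proof (induction m arbitrary: w rule: dec_induct)
  case (step m)
  then show ?case by (simp add: theta_cur_Suc scale_right_diff_distrib mult.commute)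
qed (simp add: theta_cur_2)

lemma theta_0: "2 \<le> m \<Longrightarrow> m \<le> n \<Longrightarrow> theta m 0 = 0"
  using theta_scale[of m 0 0] by simp

text \<open>Every summand of the expanded commutator contains each index below m exactly once, so
  all of them acquire the same factor.\<close>

lemma theta_twist:
  assumes "2 \<le> m" "m \<le> n"
    and A: "Vector_Spaces.linear scale scale A"
    and comm: "\<And>j l w. j \<in> {1..<m} \<Longrightarrow>
      A (cur M Neg j (int l) w) = scale (b j) (cur M Neg j (int l) (A w))"
  shows "A (theta m w) = scale (\<Prod>j\<in>{1..<m}. b j) (theta m (A w))"
  using assms(1,2) comm
proof (induction m arbitrary: w rule: dec_induct)
  case base
  moreover have "{1..<2} = {1::nat}" by auto
  ultimately show ?case using base(2)[of 1 1 w] by (simp add: theta_cur_2)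
next
  case (step m)
  note [simp] = linear_rules[OF A]
  have IH: "A (theta m w) = scale (\<Prod>j\<in>{1..<m}. b j) (theta m (A w))" for w
    using step by simp
  have "A (cur M Neg m 0 w) = scale (b m) (cur M Neg m 0 (A w))" for w
    using step(1) step(5)[of m 0] by simp
  then show ?case using step(1,4)
    by (simp add: theta_cur_Suc IH theta_scale scale_right_diff_distrib mult_ac)
qed

lemma theta_commute:
  assumes "2 \<le> m" "m \<le> n"
    and "Vector_Spaces.linear scale scale A"
    and "\<And>j l w. j \<in> {1..<m} \<Longrightarrow> A (cur M Neg j (int l) w) = cur M Neg j (int l) (A w)"
  shows "A (theta m w) = theta m (A w)"
  using theta_twist[of m A "\<lambda>_. 1"] assms by simp

lemma prod_cartan:
  assumes "2 \<le> m"
  shows "(\<Prod>j\<in>{1..<m}. q powi (a * cartan m j)) = q powi (- a)"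
proof -
  have "(\<Prod>j\<in>{1..<m}. q powi (a * cartan m j))
      = (\<Prod>j\<in>{1..<m}. if j = m - 1 then q powi (- a) else 1)"
    by (intro prod.cong) (auto simp: cartan_def)
  then show ?thesis using assms by simp
qed

lemma psi_0_theta:
  assumes "2 \<le> m" "m < n"
  shows "psi M m 0 (theta m w) = scale q (theta m (psi M m 0 w))"
  using theta_twist[of m "psi M m 0" "\<lambda>j. q powi (- 1 * cartan m j)" w, unfolded prod_cartan[OF assms(1)]]
    psi_0_cur[of m _ Neg] psi_linear[of m] assms by simp

lemma phi_0_theta:
  assumes "2 \<le> m" "m < n"
  shows "phi M m 0 (theta m w) = scale (inverse q) (theta m (phi M m 0 w))"
  using theta_twist[of m "phi M m 0" "\<lambda>j. q powi (1 * cartan m j)" w, unfolded prod_cartan[OF assms(1)]]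
    phi_0_cur[of m _ Neg] phi_linear[of m] assms by (simp add: power_int_minus)

lemma cur_Pos_Neg_commute:
  assumes "i \<in> {1..<n}" "j \<in> {1..<n}" "i \<noteq> j"
  shows "cur M Pos i k (cur M Neg j (int l) v) = cur M Neg j (int l) (cur M Pos i k v)"
  using cur_Pos_Neg[OF assms(1,2), of k l v] assms(3) by simp

lemma cur_Pos_Neg_0:
  assumes "i \<in> {1..<n}"
  shows "cur M Pos i 0 (cur M Neg i 0 v) = cur M Neg i 0 (cur M Pos i 0 v)
    + scale (1 / (q - inverse q)) (psi M i 0 v - phi M i 0 v)"
  using cur_Pos_Neg[OF assms assms, of 0 0 v] by (simp add: psi_mode_def phi_mode_def algebra_simps)

text \<open>Apply \<open>x\<^sup>+\<^sub>m(0)\<close> to \<open>theta (Suc m) v\<close>: it commutes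
  with \<open>theta m\<close> and kills \<open>v\<close>, so only its commutators with
  \<open>x\<^sup>-\<^sub>m(0)\<close> survive.\<close>

lemma theta_descend:
  assumes m: "2 \<le> m" "m < n"
    and psi: "psi M m 0 v = scale s v" and phi: "phi M m 0 v = scale (inverse s) v"
    and "s \<noteq> 0" and v: "cur M Pos m 0 v = 0"
    and 0: "theta (Suc m) v = 0"
  shows "theta m v = 0"
proof -
  let ?\<kappa> = "1 / (q - inverse q)"
  have i: "m \<in> {1..<n}" using m by simp
  have comm: "cur M Pos m 0 (theta m w) = theta m (cur M Pos m 0 w)" for w
    using m by (intro theta_commute cur_linear_int cur_Pos_Neg_commute) auto
  have "0 = cur M Pos m 0 (theta (Suc m) v)"
    using 0 i by simp
  \<comment> \<open>The first term has the eigenvalue \<open>q * s\<close> of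
    \<open>psi M m 0\<close> on \<open>theta m v\<close>, the second the eigenvalue \<open>s\<close>
    on \<open>v\<close>.\<close>
  also have "\<dots> = scale (?\<kappa> * (q * s - inverse q * inverse s) - inverse q * (?\<kappa> * (s - inverse s)))
      (theta m v)"
    using m i by (simp add: theta_cur_Suc comm cur_Pos_Neg_0 v theta_0 theta_scale psi phi
        psi_0_theta phi_0_theta flip: scale_left_diff_distrib)
  also have "?\<kappa> * (q * s - inverse q * inverse s) - inverse q * (?\<kappa> * (s - inverse s))
      = ?\<kappa> * (q - inverse q) * s"
    by (simp only: right_diff_distrib left_diff_distrib) (simp add: mult_ac)
  also have "\<dots> = s"
    using q_minus_inverse_nonzero by (simp del: q_minus_inverse_nonzero)
  finally show ?thesis using \<open>s \<noteq> 0\<close> by simp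
qed

text \<open>Applied to \<open>vhw\<close>, these words carry the mode 1 from index 1 along the
  Dynkin diagram to index r.\<close>

definition neg_word :: "nat \<Rightarrow> nat \<Rightarrow> 'v \<Rightarrow> 'v" where
  "neg_word m r = foldr (\<lambda>j. cur M Neg j 0) [m..<Suc r]"

lemma neg_word_empty: "neg_word (Suc r) r w = w"
  by (simp add: neg_word_def)

lemma neg_word_Cons: "m \<le> r \<Longrightarrow> neg_word m r w = cur M Neg m 0 (neg_word (Suc m) r w)"
  by (simp add: neg_word_def upt_conv_Cons del: upt_Suc)

lemma neg_word_commute:
  assumes "\<And>j w. j \<in> {m..r} \<Longrightarrow> A (cur M Neg j 0 w) = cur M Neg j 0 (A w)"
  shows "A (neg_word m r w) = neg_word m r (A w)"
proof -
  have "A (foldr (\<lambda>j. cur M Neg j 0) xs w) = foldr (\<lambda>j. cur M Neg j 0) xs (A w)"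
    if "set xs \<subseteq> {m..r}" for xs
    using that by (induction xs) (simp_all add: assms)
  then show ?thesis by (simp add: neg_word_def atLeastLessThanSuc_atLeastAtMost del: upt_Suc)
qed

lemma neg_word_scale: "1 \<le> m \<Longrightarrow> r < n \<Longrightarrow> neg_word m r (scale a w) = scale a (neg_word m r w)"
  by (rule neg_word_commute[symmetric]) simp

lemma neg_word_0: "1 \<le> m \<Longrightarrow> r < n \<Longrightarrow> neg_word m r 0 = 0"
  using neg_word_scale[of m r 0 0] by simp

end

locale level_highest_weight_module =
  integrable_highest_weight_module scale n M hw vhw + level_module scale n M c
  for scale :: "base \<Rightarrow> 'v \<Rightarrow> 'v::ab_group_add" and n M hw vhw c +
  assumes n_ge_2: "n \<ge> 2"
begin

lemma cur_Pos_0_vhw: "i \<in> {1..<n} \<Longrightarrow> cur M Pos i 0 vhw = 0"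
  using e_vhw[of i] by (simp add: chev_e_def)

lemma psi_0_vhw: "i \<in> {1..<n} \<Longrightarrow> psi M i 0 vhw = scale (q ^ hw i) vhw"
  using t_vhw[of i] by (simp add: chev_t_def)

lemma phi_0_vhw: "i \<in> {1..<n} \<Longrightarrow> phi M i 0 vhw = scale (inverse (q ^ hw i)) vhw"
  using phi_0_psi_0[of i vhw] psi_0_vhw[of i] by (metis phi_rules(4) q_nonzero power_not_zero
      left_inverse scale_one scale_scale)

text \<open>The Cartan generator in \<open>e\<^sub>0\<close> acts on \<open>vhw\<close> by a nonzero
  scalar, which gives the case m = n; \<open>theta_descend\<close> then lowers m.\<close>

lemma theta_vhw: "m \<le> n \<Longrightarrow> 2 \<le> m \<Longrightarrow> theta m vhw = 0"
proof (induction m rule: inc_induct)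
  case base
  have "theta n (scale (q ^ hw 0) vhw) = 0"
    using e_vhw[of 0] t_vhw[of 0] n_ge_2 by (simp add: chev_e_def)
  then show ?case using n_ge_2 by (simp add: theta_scale)
next
  case (step m)
  then show ?case
    by (intro theta_descend[of m vhw "q ^ hw m"])
      (simp_all add: psi_0_vhw phi_0_vhw cur_Pos_0_vhw)
qed

text \<open>Expand \<open>theta (Suc m)\<close> on the word starting at m + 1. In the first summand
  \<open>theta m\<close> commutes with all letters and reaches \<open>vhw\<close>, which it kills;
  the second is a nonzero multiple of the claim for m.\<close>

lemma theta_neg_word:
  assumes "r < n"
  shows "m \<le> Suc r \<Longrightarrow> 2 \<le> m \<Longrightarrow> theta m (neg_word m r vhw) = 0"
proof (induction m rule: inc_induct)
  case base
  then show ?case using assms by (simp add: neg_word_empty theta_vhw)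
next
  case (step m)
  have "theta m (neg_word (Suc m) r vhw) = neg_word (Suc m) r (theta m vhw)"
  proof (rule neg_word_commute)
    fix j w assume "j \<in> {Suc m..r}"
    then show "theta m (cur M Neg j 0 w) = cur M Neg j 0 (theta m w)"
      using step assms
      by (intro theta_commute[symmetric] cur_linear_int cur_commute) (auto simp: cartan_def)
  qed
  also have "\<dots> = 0" using step assms by (simp add: theta_vhw neg_word_0)
  finally show ?case using step assms by (simp add: theta_cur_Suc neg_word_Cons)
qed

text \<open>Applying \<open>x\<^sup>+\<^sub>j(0)\<close> to \<open>x\<^sup>-\<^sub>j(1) x\<^sup>-\<^sub>j\<^sub>+\<^sub>1(0) \<dots> x\<^sup>-\<^sub>r(0) v = 0\<close> gives the same with \<open>\<psi>\<^sub>j(1)\<close> in place of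
  \<open>x\<^sup>-\<^sub>j(1)\<close>, and moving \<open>\<psi>\<^sub>j(1)\<close> to the right raises the mode of \<open>x\<^sup>-\<^sub>j\<^sub>+\<^sub>1(0)\<close>.\<close>

lemma cur_Neg_1_vhw: "r \<in> {1..<n} \<Longrightarrow> cur M Neg r 1 vhw = 0"
proof (induction r rule: less_induct)
  case (less r)
  \<comment> \<open>The case j = 1 is \<open>theta_neg_word\<close> for \<open>theta 2\<close>; at j
    = r the word is empty.\<close>
  have "cur M Neg j 1 (neg_word (Suc j) r vhw) = 0" if "1 \<le> j" "j \<le> r" for j
    using that
  proof (induction j rule: dec_induct)
    case base
    then show ?case using theta_neg_word[of r 2] less
      by (simp add: theta_cur_2 flip: numeral_2_eq_2)
  next
    case (step j)
    let ?w = "neg_word (Suc (Suc j)) r vhw"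
    have j: "j \<in> {1..<n}" "Suc j \<in> {1..<n}" using step less by auto
    have psi_1: "psi M j 1 (neg_word (Suc j) r vhw) = 0"
    proof (rule psi_eq_0[OF j(1)])
      have "cur M Pos j 0 (neg_word (Suc j) r vhw) = neg_word (Suc j) r (cur M Pos j 0 vhw)"
        using j less.prems cur_Pos_Neg_commute[OF j(1), of _ 0 0]
        by (intro neg_word_commute) simp
      then show "cur M Pos j 0 (neg_word (Suc j) r vhw) = 0"
        using less.prems by (simp add: cur_Pos_0_vhw[OF j(1)] neg_word_0)
    qed (use step in simp_all)
    have psi_w: "psi M j m ?w = neg_word (Suc (Suc j)) r (psi M j m vhw)" for m
      using j less.prems psi_cur_orthogonal[OF j(1), of _ m Neg 0]
      by (intro neg_word_commute) (simp add: cartan_def)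
    \<comment> \<open>Since j < r, the outer induction gives
      \<open>x\<^sup>-\<^sub>j(1) v = 0\<close>.\<close>
    have "psi M j 1 vhw = 0"
      using j step less by (intro psi_eq_0 cur_Pos_0_vhw) auto
    then have "psi M j 1 ?w = 0" using psi_w less.prems by (simp add: neg_word_0)
    moreover have "psi M j 0 ?w = scale (q ^ hw j) ?w"
      using psi_w less.prems j by (simp add: neg_word_scale psi_0_vhw)
    ultimately have "cur M Neg (Suc j) (int (Suc 0)) ?w = 0"
      using psi_1 step by (intro cur_raise[OF j(2,1), where s = "q ^ hw j"]) (simp_all add: cartan_def neg_word_Cons)
    then show ?case by simp
  qed
  from this[of r] show ?case using less.prems by (simp add: neg_word_empty)
qed

lemma psi_1_vhw: "i \<in> {1..<n} \<Longrightarrow> psi M i 1 vhw = 0"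
  by (rule psi_eq_0) (simp_all add: cur_Pos_0_vhw cur_Neg_1_vhw)

lemma cur_raise_vhw:
  assumes i: "i \<in> {1..<n}" and "cur M e i (int l) vhw = 0"
  shows "cur M e i (int (Suc l)) vhw = 0"
  using assms psi_1_vhw[OF i] psi_0_vhw[OF i]
  by (intro cur_raise[OF i i, where s = "q ^ hw i"]) (simp_all add: cartan_def)

lemma truncated_vhw: "truncated vhw"
proof -
  have pos: "cur M Pos i (int l) vhw = 0" if "i \<in> {1..<n}" for i l
  proof (induction l)
    case 0
    then show ?case using cur_Pos_0_vhw[OF that] by simp
  next
    case (Suc l)
    then show ?case by (rule cur_raise_vhw[OF that])
  qed
  have neg: "cur M Neg i (int (Suc l)) vhw = 0" if "i \<in> {1..<n}" for i l
  proof (induction l)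
    case 0
    then show ?case using cur_Neg_1_vhw[OF that] by simp
  next
    case (Suc l)
    then show ?case by (rule cur_raise_vhw[OF that])
  qed
  have "(\<forall>e. cur M e i (int m) vhw = 0) \<and> psi M i m vhw = 0" if i: "i \<in> {1..<n}" and "1 \<le> m" for i m
  proof -
    obtain l where m: "m = Suc l" using \<open>1 \<le> m\<close> by (cases m) auto
    have "cur M e i (int m) vhw = 0" for e
      using pos[OF i, of m] neg[OF i, of l] m by (cases e) simp_all
    moreover have "psi M i m vhw = 0"
      using neg[OF i] m by (intro psi_eq_0[OF i]) (simp_all add: cur_Pos_0_vhw[OF i])
    ultimately show ?thesis by blast
  qed
  then show ?thesis unfolding truncated_def eventually_sequentially by blast
qed

lemma truncated: "truncated v"
  using cyclic[OF submodule_truncated] truncated_vhw by auto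

section \<open>The grading and the matrix coefficients\<close>

lemma weight_vectors_span: "span {v. \<exists>\<beta> d. weight_vector scale n M vhw \<beta> d v} = UNIV"
proof -
  let ?B = "{v. \<exists>\<beta> d. weight_vector scale n M vhw \<beta> d v}"
  have stable: "h v \<in> span ?B"
    if h: "Vector_Spaces.linear scale scale h" "\<And>u. u \<in> ?B \<Longrightarrow> h u \<in> ?B" and "v \<in> span ?B" for h v
  proof -
    have "?B \<subseteq> {u. h u \<in> span ?B}"
    proof (rule subsetI, rule CollectI)
      fix u assume "u \<in> ?B"
      then show "h u \<in> span ?B" by (rule h(2)[THEN span_base])
    qed
    moreover have "subspace {u. h u \<in> span ?B}"
      by (rule subspaceI) (simp_all add: linear_rules[OF h(1)] span_add span_scale span_zero)
    ultimately have "span ?B \<subseteq> {u. h u \<in> span ?B}"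
      by (rule span_minimal)
    then show ?thesis using \<open>v \<in> span ?B\<close> by blast
  qed
  have "submodule scale n M (span ?B)"
    unfolding submodule_def
  proof (intro conjI ballI allI)
    show "subspace (span ?B)" by (rule subspace_span)
    fix v assume v: "v \<in> span ?B"
    show "qc M j v \<in> span ?B" for j
      using v by (simp add: span_scale)
    fix i assume i: "i \<in> {1..<n}"
    show "phi M i m v \<in> span ?B" for m
      by (rule stable[OF phi_linear[OF i] _ v]) (use i in \<open>blast intro: weight_vector.phi\<close>)
    show "psi M i m v \<in> span ?B" for m
      by (rule stable[OF psi_linear[OF i] _ v]) (use i in \<open>blast intro: weight_vector.psi\<close>)
    show "cur M e i l v \<in> span ?B" for e l
      by (rule stable[OF cur_linear_int[OF i] _ v]) (use i in \<open>blast intro: weight_vector.cur\<close>)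
  qed
  moreover have "vhw \<in> span ?B" by (intro span_base) (auto intro: weight_vector.highest)
  ultimately show ?thesis by (rule cyclic)
qed

lemma restricted_dual_rules:
  assumes "f \<in> restricted_dual scale n M vhw"
  shows "f 0 = 0" and "f (x + y) = f x + f y" and "f (x - y) = f x - f y"
    and "f (scale a x) = a * f x"
proof -
  interpret Vector_Spaces.linear scale "(*)" f using assms by (simp add: restricted_dual_def)
  show "f 0 = 0" "f (x + y) = f x + f y" "f (x - y) = f x - f y" "f (scale a x) = a * f x"
    by (simp_all add: add diff local.scale)
qed

text \<open>On a weight vector of degree d the product has degree d + k + l, and \<open>f\<close> is
  nonzero on finitely many weight spaces only. Weight vectors span, and finiteness passes to linear
  combinations.\<close>

lemma finite_total_degree:
  assumes f: "f \<in> restricted_dual scale n M vhw" and i: "i \<in> {1..<n}" and j: "j \<in> {1..<n}"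
  shows "finite {k + l | k l. f (cur M e i k (cur M e j l v)) \<noteq> 0}"
proof -
  define D where "D = (\<lambda>v. {k + l | k l. f (cur M e i k (cur M e j l v)) \<noteq> 0})"
  note [simp] = restricted_dual_rules[OF f]
  have "subspace {v. finite (D v)}"
  proof (rule subspaceI)
    show "0 \<in> {v. finite (D v)}" using i j by (simp add: D_def)
  next
    fix x y assume "x \<in> {v. finite (D v)}" "y \<in> {v. finite (D v)}"
    then have "finite (D x \<union> D y)" by simp
    moreover have "D (x + y) \<subseteq> D x \<union> D y"
      using i j by (auto simp: D_def) (metis add_0)
    ultimately show "x + y \<in> {v. finite (D v)}" using finite_subset by blast
  next
    fix a x assume "x \<in> {v. finite (D v)}"
    moreover have "D (scale a x) \<subseteq> D x" using i j by (auto simp: D_def)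
    ultimately show "scale a x \<in> {v. finite (D v)}" using finite_subset by blast
  qed
  moreover have "finite (D v)" if v: "weight_vector scale n M vhw \<beta> d v" for \<beta> d v
  proof -
    let ?F = "{(\<beta>, d). \<exists>v\<in>weight_space scale n M vhw \<beta> d. f v \<noteq> 0}"
    have "D v \<subseteq> (\<lambda>(\<beta>, d'). d' - d) ` ?F"
    proof
      fix s assume "s \<in> D v"
      then obtain k l where s: "s = k + l" "f (cur M e i k (cur M e j l v)) \<noteq> 0"
        by (auto simp: D_def)
      have "\<exists>\<beta>'. weight_vector scale n M vhw \<beta>' (d + l + k) (cur M e i k (cur M e j l v))"
        using weight_vector.cur[OF weight_vector.cur[OF v j] i] by blast
      then obtain \<beta>' where "(\<beta>', d + l + k) \<in> ?F" using s by (auto simp: weight_space_def)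
      then show "s \<in> (\<lambda>(\<beta>, d'). d' - d) ` ?F"
        by (rule rev_image_eqI) (simp add: s)
    qed
    then show ?thesis using f finite_subset by (auto simp: restricted_dual_def)
  qed
  ultimately have "span {v. \<exists>\<beta> d. weight_vector scale n M vhw \<beta> d v} \<subseteq> {v. finite (D v)}"
    by (intro span_minimal) auto
  then show ?thesis unfolding weight_vectors_span D_def by blast
qed

lemma at_most_poles_at_cur:
  assumes f: "f \<in> restricted_dual scale n M vhw" and i: "i \<in> {1..<n}" and j: "j \<in> {1..<n}"
  shows "at_most_poles_at (correlation f (cur M e i) (cur M e j) v) (q powi (- sgn_pm e * cartan i j))"
proof -
  define b where "b = q powi (sgn_pm e * cartan i j)"
  define C where "C = correlation f (cur M e i) (cur M e j) v"
  note [simp] = restricted_dual_rules[OF f]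
  obtain N where N: "\<And>i e m. i \<in> {1..<n} \<Longrightarrow> N \<le> m \<Longrightarrow> cur M e i (int m) v = 0"
    using truncatedE[OF truncated] by metis
  have N': "cur M e i l v = 0" if "i \<in> {1..<n}" "int N \<le> l" for i e l
    using N[of i "nat l" e] that by simp
  define T where "T = {k + l | k l. C k l \<noteq> 0}"
  have T: "finite T"
    unfolding T_def C_def correlation_def by (rule finite_total_degree[OF f i j])
  have TI: "C k l = 0" if "k + l \<notin> T" for k l using that by (auto simp: T_def)
  have C_0: "C k l = 0" if "l \<ge> int N" for k l
    using that N'[OF j] i by (simp add: C_def correlation_def)
  \<comment> \<open>For such k the right-hand side of the quadratic relation vanishes, as its inner
    modes \<open>k\<close> and \<open>k + 1\<close> kill \<open>v\<close>.\<close>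
  have E: "C (k + 1) l - b * C k (l + 1) = 0" if "k \<ge> int N" for k l
  proof -
    have "C (k + 1) l - b * C k (l + 1)
        = f (cur M e i (k + 1) (cur M e j l v) - scale b (cur M e i k (cur M e j (l + 1) v)))"
      by (simp add: C_def correlation_def)
    also have "\<dots> = f (scale b (cur M e j l (cur M e i (k + 1) v)) - cur M e j (l + 1) (cur M e i k v))"
      unfolding b_def using that by (subst cur_cur_int[OF i j]) auto
    also have "\<dots> = 0" using that N'[OF i] j by simp
    finally show ?thesis .
  qed
  have "at_most_poles_at C (inverse b)"
  proof (rule at_most_poles_atI[where L = "int N"])
    \<comment> \<open>Both indices are below \<open>N\<close> and k + l + 1 lies in the finite set
      \<open>T\<close>, so finitely many pairs remain.\<close>
    have "{(k, l). C (k + 1) l - b * C k (l + 1) \<noteq> 0}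
        \<subseteq> (\<Union>t\<in>T. (\<lambda>k. (k, t - 1 - k)) ` {t - 1 - int N..int N})"
    proof clarify
      fix k l assume nz: "C (k + 1) l - b * C k (l + 1) \<noteq> 0"
      have "k < int N" using E[of k l] nz by force
      moreover have "l < int N" using C_0[of l "k + 1"] C_0[of "l + 1" k] nz by force
      moreover have "k + l + 1 \<in> T" using TI[of "k + 1" l] TI[of k "l + 1"] nz
        by (force simp: algebra_simps)
      ultimately show "(k, l) \<in> (\<Union>t\<in>T. (\<lambda>k. (k, t - 1 - k)) ` {t - 1 - int N..int N})"
        by (intro UN_I[of "k + l + 1"] image_eqI[of _ _ k]) auto
    qed
    then show "finite {(k, l). C (k + 1) l - b * C k (l + 1) \<noteq> 0}"
      by (rule finite_subset) (simp add: T)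
    show "\<exists>K. \<forall>k<K. C k l = 0" for l
    proof (intro exI allI impI TI notI)
      fix k assume "k < Min (insert 0 T) - l" "k + l \<in> T"
      moreover from this have "Min (insert 0 T) \<le> k + l" using T by simp
      ultimately show False by simp
    qed
  qed (use C_0 in \<open>auto simp: b_def\<close>)
  then show ?thesis by (simp add: b_def C_def power_int_minus)
qed

end

theorem proposition9:
  fixes scale :: "base \<Rightarrow> 'v \<Rightarrow> 'v::ab_group_add"
    and n k :: nat
    and M :: "'v currents"
    and hw :: "nat \<Rightarrow> nat"
    and vhw :: 'v
  assumes "n \<ge> 2"
    and "k \<ge> 1"
    and "integrable_highest_weight_module scale n M hw vhw"
    and "level scale M k"
  shows "(\<forall>i\<in>{1..<n}. \<forall>v. \<forall>f\<in>restricted_dual scale n M vhw.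
            at_most_poles_at (correlation f (cur M Pos i) (cur M Pos i) v) (q powi - 2)) \<and>
         (\<forall>i\<in>{1..<n}. \<forall>j\<in>{1..<n}. j = i + 1 \<or> i = j + 1 \<longrightarrow>
            (\<forall>v. \<forall>f\<in>restricted_dual scale n M vhw.
              at_most_poles_at (correlation f (cur M Pos j) (cur M Pos i) v) q)) \<and>
         (\<forall>i\<in>{1..<n}. \<forall>v. \<forall>f\<in>restricted_dual scale n M vhw.
            at_most_poles_at (correlation f (cur M Neg i) (cur M Neg i) v) (q powi 2)) \<and>
         (\<forall>i\<in>{1..<n}. \<forall>j\<in>{1..<n}. j = i + 1 \<or> i = j + 1 \<longrightarrow>
            (\<forall>v. \<forall>f\<in>restricted_dual scale n M vhw.
              at_most_poles_at (correlation f (cur M Neg j) (cur M Neg i) v) (q powi - 1)))"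
proof -
  interpret integrable_highest_weight_module scale n M hw vhw by fact
  interpret level_highest_weight_module scale n M hw vhw k
    by unfold_locales (fact assms)+
  have adjacent: "cartan j i = - 1" if "j = i + 1 \<or> i = j + 1" for i j
    using that by (auto simp: cartan_def)
  have equal: "cartan i i = 2" for i by (simp add: cartan_def)
  \<comment> \<open>The constant of the locus is q^(-a) for \<open>Pos\<close> and q^a for
    \<open>Neg\<close>, with a = 2 for equal and a = -1 for adjacent indices.\<close>
  note Pos = at_most_poles_at_cur[where e = Pos] and Neg = at_most_poles_at_cur[where e = Neg]
  show ?thesis
  proof (intro conjI ballI allI impI)
    fix i v f assume "i \<in> {1..<n}" "f \<in> restricted_dual scale n M vhw"
    from Pos[OF this(2,1,1), of v] Neg[OF this(2,1,1), of v]
    show "at_most_poles_at (correlation f (cur M Pos i) (cur M Pos i) v) (q powi - 2)"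
      and "at_most_poles_at (correlation f (cur M Neg i) (cur M Neg i) v) (q powi 2)"
      by (simp_all only: equal sgn_pm.simps) simp_all
  next
    fix i j v f
    assume "i \<in> {1..<n}" "j \<in> {1..<n}" and ij: "j = i + 1 \<or> i = j + 1"
      and "f \<in> restricted_dual scale n M vhw"
    from Pos[OF this(4,2,1), of v] Neg[OF this(4,2,1), of v]
    show "at_most_poles_at (correlation f (cur M Pos j) (cur M Pos i) v) q"
      and "at_most_poles_at (correlation f (cur M Neg j) (cur M Neg i) v) (q powi - 1)"
      by (simp_all only: adjacent[OF ij] sgn_pm.simps) simp_all
  qed
qed

end
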